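(* Let $n\ge 1$ and $d\ge 1$ be integers. There is a constant $M=M(n,d)>0$, depending only on $n$ and $d$, such that for every closed set $Z\subset \hat B^n$ with box dimension $\dim_e(Z)>n-\frac{1}{d+1}$ one has $$\mathcal{RG}_d(Z)\ge M .$$
   Context: $B^n\subset\mathbb{R}^n$ is the closed unit ball and $\hat B^n$ is the concentric closed ball of radius $\frac13$. For a $C^{d+1}$-smooth function $f:B^n\to\mathbb{R}$ and $0\le l\le d+1$, put $M_l(f)=\max_{z\in B^n}\|f^{(l)}(z)\|$, where $\|f^{(l)}(z)\|$ is the maximum of the absolute values of all partial derivatives of $f$ of order $l$ at $z$ (so $M_0(f)=\max_{B^n}|f|$). For $Z\subset\hat B^n$, let $U_d(Z)$ be the set of all $C^{d+1}$-smooth functions $f:B^n\to\mathbb{R}$ vanishing on $Z$ (and possibly elsewhere) with $M_0(f)=1$. The $d$-rigidity of $Z$ is $\mathcal{RG}_d(Z)=\inf_{f\in U_d(Z)}M_{d+1}(f)$. For $\epsilon>0$ subdivide $\mathbb{R}^n$ into the closed regular grid of $\epsilon$-cubes $\prod_{i}[k_i\epsilon,(k_i+1)\epsilon]$, $k\in\mathbb{Z}^n$. The covering number $M(\epsilon,Z)$ is the number of these cubes that intersect $Z$. The box (Minkowski, entropy) dimension is $\dim_e(Z)=\limsup_{\epsilon\to0}\frac{\log M(\epsilon,Z)}{\log(1/\epsilon)}$. *)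

theory Defs
  imports "HOL-Analysis.Analysis"
begin

text \<open>
  A function on the closed unit ball is represented by a total function on \<^typ>\<open>real^'n\<close> whose
  values outside the ball are irrelevant: all derivatives are taken within the ball. As the ball
  is convex with nonempty interior, the derivative within it is unique also at boundary points.
\<close>

abbreviation unit_ball :: "(real^'n) set" where
  "unit_ball \<equiv> cball 0 1"

definition partial_deriv :: "'n::finite \<Rightarrow> (real^'n \<Rightarrow> real) \<Rightarrow> real^'n \<Rightarrow> real" where
  "partial_deriv i f = (\<lambda>x. frechet_derivative f (at x within unit_ball) (axis i 1))"

primrec iter_partial_deriv :: "'n::finite list \<Rightarrow> (real^'n \<Rightarrow> real) \<Rightarrow> real^'n \<Rightarrow> real" where
  "iter_partial_deriv [] f = f"
| "iter_partial_deriv (i # is) f = partial_deriv i (iter_partial_deriv is f)"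

text \<open>
  On the closed ball this is the same as being \<open>C\<^sup>k\<close> in the interior with all partial derivatives
  of order at most \<open>k\<close> extending continuously to the boundary.
\<close>

primrec Ck_smooth :: "nat \<Rightarrow> (real^'n::finite \<Rightarrow> real) \<Rightarrow> bool" where
  "Ck_smooth 0 f \<longleftrightarrow> continuous_on unit_ball f"
| "Ck_smooth (Suc k) f \<longleftrightarrow>
     f differentiable_on unit_ball \<and> (\<forall>i. Ck_smooth k (partial_deriv i f))"

definition deriv_norm :: "nat \<Rightarrow> (real^'n::finite \<Rightarrow> real) \<Rightarrow> real^'n \<Rightarrow> real" where
  "deriv_norm l f z = Max {\<bar>iter_partial_deriv is f z\<bar> | is. length is = l}"

text \<open>
  For \<open>f\<close> of class \<open>C\<^sup>l\<close> the supremum below is attained, since the ball is compact.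
\<close>

definition M_deriv :: "nat \<Rightarrow> (real^'n::finite \<Rightarrow> real) \<Rightarrow> real" where
  "M_deriv l f = (SUP z\<in>unit_ball. deriv_norm l f z)"

definition U_class :: "nat \<Rightarrow> (real^'n::finite) set \<Rightarrow> (real^'n \<Rightarrow> real) set" where
  "U_class d Z = {f. Ck_smooth (d + 1) f \<and> (\<forall>z\<in>Z. f z = 0) \<and> M_deriv 0 f = 1}"

definition rigidity :: "nat \<Rightarrow> (real^'n::finite) set \<Rightarrow> ereal" where
  "rigidity d Z = (INF f\<in>U_class d Z. ereal (M_deriv (d + 1) f))"

definition grid_cubes :: "real \<Rightarrow> (real^'n::finite) set set" where
  "grid_cubes \<epsilon> =
     range (\<lambda>k::int^'n. cbox (\<chi> i. of_int (k $ i) * \<epsilon>) (\<chi> i. (of_int (k $ i) + 1) * \<epsilon>))"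

definition covering_number :: "real \<Rightarrow> (real^'n::finite) set \<Rightarrow> nat" where
  "covering_number \<epsilon> Z = card {Q \<in> grid_cubes \<epsilon>. Q \<inter> Z \<noteq> {}}"

text \<open>
  Meant for bounded \<open>Z\<close>, where the covering numbers are finite. Since \<^term>\<open>ln 0 = (0::real)\<close>,
  the empty set gets dimension \<open>0\<close> rather than \<open>-\<infinity>\<close>.
\<close>

definition box_dim :: "(real^'n::finite) set \<Rightarrow> ereal" where
  "box_dim Z = Limsup (at_right 0) (\<lambda>\<epsilon>. ereal (ln (real (covering_number \<epsilon> Z)) / ln (1 / \<epsilon>)))"

end

theory Submission
  imports Defs
begin

text \<open>
  If \<open>M_deriv (d + 1) f\<close> is small while \<open>M_deriv 0 f = 1\<close>, Taylor expansion shows that at every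
  point of the open ball some directional derivative of order \<open>k \<le> d\<close> does not vanish. Near a zero of
  \<open>f\<close> such a derivative, of order \<open>k \<ge> 1\<close>, stays away from \<open>0\<close>, so on lines in its direction
  the sublevel sets of \<open>\<bar>f\<bar>\<close> are small and \<open>{x. \<bar>f x\<bar> \<le> \<delta>}\<close> locally has measure \<open>O(\<delta>\<^sup>1\<^sup>/\<^sup>k)\<close>.
  As \<open>f\<close> is Lipschitz, the \<open>\<epsilon>\<close>-cubes meeting the zero set lie in such a sublevel set with
  \<open>\<delta> = O(\<epsilon>)\<close>. Hence the zero set has box dimension at most \<open>n - 1/d\<close>, which is less than
  \<open>n - 1/(d + 1)\<close>.
\<close>

section \<open>Smoothness classes and the bound by \<open>M_deriv\<close>\<close>

lemma Ck_smooth_continuous_on: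
  "Ck_smooth k f \<Longrightarrow> continuous_on unit_ball f"
  by (cases k) (auto intro: differentiable_imp_continuous_on)

lemma Ck_smooth_Suc_imp: "Ck_smooth (Suc k) f \<Longrightarrow> Ck_smooth k f"
proof (induction k arbitrary: f)
  case 0
  then show ?case
    using Ck_smooth_continuous_on[of "Suc 0" f] by simp
qed auto

lemma Ck_smooth_mono: "Ck_smooth m f \<Longrightarrow> k \<le> m \<Longrightarrow> Ck_smooth k f"
  by (induction m) (auto simp del: Ck_smooth.simps simp: le_Suc_eq intro: Ck_smooth_Suc_imp)

lemma iter_partial_deriv_append:
  "iter_partial_deriv (is @ js) f = iter_partial_deriv is (iter_partial_deriv js f)"
  by (induction "is") auto

lemma Ck_smooth_iter_partial_deriv:
  "Ck_smooth (k + length is) f \<Longrightarrow> Ck_smooth k (iter_partial_deriv is f)"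
proof (induction "is" arbitrary: k)
  case (Cons i "is")
  have "Ck_smooth (Suc k) (iter_partial_deriv is f)"
    using Cons.IH[of "Suc k"] Cons.prems by (simp del: Ck_smooth.simps)
  then show ?case by simp
qed auto

lemma finite_lists_UNIV_length: "finite {is :: 'n::finite list. length is = l}"
  using finite_lists_length_eq[of "UNIV :: 'n set" l] by simp

text \<open>The supremum in \<open>M_deriv\<close> dominates its members only if they are bounded
  above. Each of the finitely many iterated partials of order \<open>l\<close> is continuous on the
  compact ball, which provides such a bound.\<close>

lemma abs_iter_partial_deriv_le_M_deriv:
  fixes f :: "real^'n::finite \<Rightarrow> real"
  assumes f: "Ck_smooth l f" and z: "z \<in> unit_ball" and len: "length is = l"
  shows "\<bar>iter_partial_deriv is f z\<bar> \<le> M_deriv l f"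
proof -
  let ?A = "{is :: 'n list. length is = l}"
  have fin: "finite {\<bar>iter_partial_deriv is f y\<bar> | is. length is = l}" for y
    using finite_lists_UNIV_length[of l, where 'n = 'n] by (auto simp: setcompr_eq_image)
  have "\<exists>B. \<forall>y\<in>unit_ball. \<bar>iter_partial_deriv js f y\<bar> \<le> B" if "js \<in> ?A" for js
  proof -
    have "continuous_on unit_ball (iter_partial_deriv js f)"
      using Ck_smooth_iter_partial_deriv[of 0 js f] f that by simp
    then have "bounded (iter_partial_deriv js f ` unit_ball)"
      using compact_cball compact_continuous_image compact_imp_bounded by blast
    then show ?thesis by (auto simp: bounded_iff)
  qed
  then obtain B where B: "\<And>js y. js \<in> ?A \<Longrightarrow> y \<in> unit_ball \<Longrightarrow> \<bar>iter_partial_deriv js f y\<bar> \<le> B js"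
    by metis
  have "deriv_norm l f y \<le> (\<Sum>js\<in>?A. \<bar>B js\<bar>)" if y: "y \<in> unit_ball" for y
    unfolding deriv_norm_def
  proof (rule Max.boundedI[OF fin])
    show "{\<bar>iter_partial_deriv is f y\<bar> | is. length is = l} \<noteq> {}"
      using len by auto
    fix a assume "a \<in> {\<bar>iter_partial_deriv is f y\<bar> | is. length is = l}"
    then obtain js where js: "js \<in> ?A" "a = \<bar>iter_partial_deriv js f y\<bar>" by auto
    have "a \<le> \<bar>B js\<bar>" using B[OF js(1) y] js(2) by linarith
    also have "\<dots> \<le> (\<Sum>js\<in>?A. \<bar>B js\<bar>)"
      using finite_lists_UNIV_length by (intro member_le_sum js) auto
    finally show "a \<le> (\<Sum>js\<in>?A. \<bar>B js\<bar>)" .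
  qed
  then have "bdd_above (deriv_norm l f ` unit_ball)" by (rule bdd_aboveI2)
  then have "deriv_norm l f z \<le> M_deriv l f"
    unfolding M_deriv_def using z by (rule cSUP_upper2) auto
  moreover have "\<bar>iter_partial_deriv is f z\<bar> \<le> deriv_norm l f z"
    unfolding deriv_norm_def using len by (intro Max_ge fin) auto
  ultimately show ?thesis by simp
qed

section \<open>Higher directional derivatives and Taylor expansion\<close>

text \<open>The operator \<open>(v . grad)^j\<close>, written through partials so that continuity
  and bounds carry over from them. The recursion applies the new partial to \<open>f\<close> itself,
  so inductions on \<open>j\<close> generalise over \<open>f\<close>.\<close>

primrec dir_deriv :: "real^'n::finite \<Rightarrow> nat \<Rightarrow> (real^'n \<Rightarrow> real) \<Rightarrow> real^'n \<Rightarrow> real" where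
  "dir_deriv v 0 f = f"
| "dir_deriv v (Suc j) f = (\<lambda>x. \<Sum>i\<in>UNIV. v $ i * dir_deriv v j (partial_deriv i f) x)"

text \<open>At interior points the derivative within the ball is the ordinary one, and a linear map
  is determined by its values on the axis vectors.\<close>

lemma frechet_derivative_eq_dir_deriv:
  fixes f :: "real^'n::finite \<Rightarrow> real"
  assumes f: "f differentiable_on unit_ball" and x: "x \<in> ball 0 1"
  shows "(f has_derivative (\<lambda>h. dir_deriv h 1 f x)) (at x)"
proof -
  have at: "at x within unit_ball = at x"
    using x by (intro at_within_interior) (auto simp: interior_cball)
  let ?F = "frechet_derivative f (at x within unit_ball)"
  have der: "(f has_derivative ?F) (at x)"
    using f x unfolding differentiable_on_def
    by (subst at[symmetric]) (auto simp flip: frechet_derivative_works)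
  then have lin: "linear ?F" by (rule has_derivative_linear)
  have "?F h = dir_deriv h 1 f x" for h
  proof -
    have "?F h = ?F (\<Sum>i\<in>UNIV. (h $ i) *\<^sub>R axis i 1)"
      using basis_expansion[of h] by (simp add: scalar_mult_eq_scaleR)
    also have "\<dots> = (\<Sum>i\<in>UNIV. h $ i * ?F (axis i 1))"
      by (simp add: linear_sum[OF lin] linear_scale[OF lin])
    finally show ?thesis by (simp add: partial_deriv_def)
  qed
  then have "?F = (\<lambda>h. dir_deriv h 1 f x)" by (rule ext)
  with der show ?thesis by simp
qed

text \<open>Only order 0 uses the chain rule; for higher orders the sum over the partials of
  \<open>f\<close> is differentiated term by term.\<close>

lemma dir_deriv_has_real_derivative:
  fixes f :: "real^'n::finite \<Rightarrow> real"
  assumes "Ck_smooth (Suc j) f" and "x + t *\<^sub>R v \<in> ball 0 1"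
  shows "((\<lambda>t. dir_deriv v j f (x + t *\<^sub>R v)) has_real_derivative
           dir_deriv v (Suc j) f (x + t *\<^sub>R v)) (at t)"
  using assms(1)
proof (induction j arbitrary: f)
  case 0
  have d: "(f has_derivative (\<lambda>h. dir_deriv h 1 f (x + t *\<^sub>R v))) (at (x + t *\<^sub>R v))"
    using 0 assms(2) by (intro frechet_derivative_eq_dir_deriv) auto
  have l: "((\<lambda>t. x + t *\<^sub>R v) has_derivative (\<lambda>s. s *\<^sub>R v)) (at t)"
    by (auto intro!: derivative_eq_intros)
  have "(\<lambda>s. dir_deriv (s *\<^sub>R v) 1 f y) = (*) (dir_deriv v (Suc 0) f y)" for y
    by (rule ext) (simp add: sum_distrib_left mult.assoc mult.commute[of "\<Sum>i\<in>UNIV. v $ i * partial_deriv i f y"])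
  then show ?case
    using has_derivative_compose[OF l d]
    by (simp add: has_field_derivative_def del: dir_deriv.simps(2))
next
  case (Suc j)
  then have "((\<lambda>t. dir_deriv v j (partial_deriv i f) (x + t *\<^sub>R v)) has_real_derivative
           dir_deriv v (Suc j) (partial_deriv i f) (x + t *\<^sub>R v)) (at t)" for i
    by (simp del: dir_deriv.simps)
  then show ?case
    unfolding dir_deriv.simps(2)[of v "Suc j"] dir_deriv.simps(2)[of v j f]
    by (intro DERIV_sum DERIV_cmult)
qed

lemma continuous_on_dir_deriv:
  "Ck_smooth j f \<Longrightarrow> continuous_on unit_ball (dir_deriv v j f)"
  by (induction j arbitrary: f) (auto intro!: continuous_intros)

text \<open>Unfolded, the derivative is a sum over index lists of products of \<open>j\<close>
  components of \<open>v\<close> times a partial of order \<open>j\<close>; the absolute products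
  add up to the \<open>j\<close>-th power of the l1 norm.\<close>

lemma abs_dir_deriv_le:
  fixes f :: "real^'n::finite \<Rightarrow> real"
  assumes "\<And>is. length is = j \<Longrightarrow> \<bar>iter_partial_deriv is f x\<bar> \<le> B"
  shows "\<bar>dir_deriv v j f x\<bar> \<le> (\<Sum>i\<in>UNIV. \<bar>v $ i\<bar>) ^ j * B"
  using assms
proof (induction j arbitrary: f)
  case 0
  then show ?case using "0"[of "[]"] by simp
next
  case (Suc j)
  have *: "\<bar>dir_deriv v j (partial_deriv i f) x\<bar> \<le> (\<Sum>i\<in>UNIV. \<bar>v $ i\<bar>) ^ j * B" for i
  proof (rule Suc.IH)
    fix js :: "'n list" assume "length js = j"
    then show "\<bar>iter_partial_deriv js (partial_deriv i f) x\<bar> \<le> B"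
      using Suc.prems[of "js @ [i]"] by (simp add: iter_partial_deriv_append)
  qed
  have "\<bar>dir_deriv v (Suc j) f x\<bar> \<le> (\<Sum>i\<in>UNIV. \<bar>v $ i * dir_deriv v j (partial_deriv i f) x\<bar>)"
    by simp
  also have "\<dots> \<le> (\<Sum>i\<in>UNIV. \<bar>v $ i\<bar> * ((\<Sum>i\<in>UNIV. \<bar>v $ i\<bar>) ^ j * B))"
    by (intro sum_mono) (auto simp: abs_mult intro!: mult_left_mono *)
  finally show ?case by (simp add: sum_distrib_right mult.assoc)
qed

lemma sum_abs_components_le: "(\<Sum>i\<in>UNIV. \<bar>v $ i\<bar>) \<le> real CARD('n) * norm (v :: real^'n::finite)"
  using sum_bounded_above[of UNIV "\<lambda>i. \<bar>v $ i\<bar>" "norm v"] component_le_norm_cart by auto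

text \<open>
  The direction can be taken towards a point where \<open>\<bar>f\<bar>\<close> is large, by Taylor's theorem along the
  segment.
\<close>

lemma ex_dir_deriv_nonzero:
  fixes f :: "real^'n::finite \<Rightarrow> real"
  assumes f: "Ck_smooth (d + 1) f" and M0: "M_deriv 0 f = 1"
    and small: "M_deriv (d + 1) f < 1 / (2 * (2 * real CARD('n)) ^ (d + 1))"
    and z: "z \<in> ball 0 1"
  shows "\<exists>v k. k \<le> d \<and> dir_deriv v k f z \<noteq> 0"
proof -
  have cont: "continuous_on unit_ball f" using f by (rule Ck_smooth_continuous_on)
  \<comment> \<open>The supremum 1 may be approached only at the boundary, while differentiation
    along lines is available in the open ball. Settling for 1/2 leaves room to move inside, by
    continuity and density.\<close>
  have "\<exists>w\<in>ball 0 1. \<bar>f w\<bar> > 1/2"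
  proof (rule ccontr)
    assume "\<not> ?thesis"
    then have le: "\<And>w. w \<in> ball 0 1 \<Longrightarrow> \<bar>f w\<bar> \<le> 1/2" by force
    have "\<bar>f w\<bar> \<le> 1/2" if "w \<in> unit_ball" for w
    proof -
      have "f ` closure (ball 0 1) \<subseteq> closure {- (1/2) .. 1/2}"
        using cont le by (intro image_closure_subset) (force simp: abs_le_iff)+
      then show ?thesis using that by (force simp: abs_le_iff)
    qed
    then have "M_deriv 0 f \<le> 1/2"
      unfolding M_deriv_def deriv_norm_def by (intro cSUP_least) auto
    with M0 show False by simp
  qed
  then obtain w where w: "w \<in> ball 0 1" "\<bar>f w\<bar> > 1/2" by blast
  define v where "v = w - z"
  have seg: "z + t *\<^sub>R v \<in> ball 0 1" if "0 \<le> t" "t \<le> 1" for t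
  proof -
    have "z + t *\<^sub>R v = (1 - t) *\<^sub>R z + t *\<^sub>R w"
      by (simp add: v_def algebra_simps)
    then show ?thesis
      using convexD[OF convex_ball z w(1), of "1 - t" t] that by simp
  qed
  \<comment> \<open>Expansion of \<open>f (z + t *\<^sub>R v)\<close> from \<open>t = 0\<close> to
    \<open>t = 1\<close>, where its value is \<open>f w\<close>.\<close>
  have "\<exists>t>0. t < 1 \<and> f (z + 1 *\<^sub>R v) = (\<Sum>m<d + 1. dir_deriv v m f (z + 0 *\<^sub>R v) / fact m * 1 ^ m) +
       dir_deriv v (d + 1) f (z + t *\<^sub>R v) / fact (d + 1) * 1 ^ (d + 1)"
  proof (rule Maclaurin)
    show "\<forall>m t. m < d + 1 \<and> 0 \<le> t \<and> t \<le> 1 \<longrightarrow>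
      ((\<lambda>t. dir_deriv v m f (z + t *\<^sub>R v)) has_real_derivative dir_deriv v (Suc m) f (z + t *\<^sub>R v)) (at t)"
      using f seg by (intro allI impI dir_deriv_has_real_derivative) (auto simp del: Ck_smooth.simps intro: Ck_smooth_mono)
  qed auto
  then obtain t where t: "0 < t" "t < 1"
    and eq: "f w = (\<Sum>m<d + 1. dir_deriv v m f z / fact m) + dir_deriv v (d + 1) f (z + t *\<^sub>R v) / fact (d + 1)"
    by (auto simp: v_def simp del: dir_deriv.simps fact_Suc)
  show ?thesis
  proof (rule ccontr)
    assume "\<not> ?thesis"
    then have "(\<Sum>m<d + 1. dir_deriv v m f z / fact m) = 0"
      by (intro sum.neutral) auto
    with eq have "\<bar>f w\<bar> = \<bar>dir_deriv v (d + 1) f (z + t *\<^sub>R v)\<bar> / fact (d + 1)"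
      by (simp del: dir_deriv.simps fact_Suc)
    also have "\<dots> \<le> \<bar>dir_deriv v (d + 1) f (z + t *\<^sub>R v)\<bar>"
      using divide_left_mono[OF fact_ge_1[of "d + 1", where 'a = real], of "\<bar>dir_deriv v (d + 1) f (z + t *\<^sub>R v)\<bar>"]
      by (simp del: dir_deriv.simps fact_Suc)
    also have "\<dots> \<le> (\<Sum>i\<in>UNIV. \<bar>v $ i\<bar>) ^ (d + 1) * M_deriv (d + 1) f"
      using t seg[of t] by (intro abs_dir_deriv_le abs_iter_partial_deriv_le_M_deriv f) auto
    also have "\<dots> \<le> (2 * real CARD('n)) ^ (d + 1) * M_deriv (d + 1) f"
    proof (rule mult_right_mono[OF power_mono])
      \<comment> \<open>Both ends lie in the unit ball. This bound and the value 1/2 at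
        \<open>w\<close> produce the threshold in \<open>small\<close>.\<close>
      have "norm v \<le> 2"
        using norm_triangle_ineq4[of w z] w z by (simp add: v_def)
      then have "real CARD('n) * norm v \<le> 2 * real CARD('n)"
        using mult_left_mono[of "norm v" 2 "real CARD('n)"] by simp
      then show "(\<Sum>i\<in>UNIV. \<bar>v $ i\<bar>) \<le> 2 * real CARD('n)"
        using sum_abs_components_le[of v] by linarith
      \<comment> \<open>Any index list of length \<open>d + 1\<close> shows that
        \<open>M_deriv (d + 1) f\<close> is nonnegative.\<close>
      have "0 \<le> \<bar>iter_partial_deriv (replicate (d + 1) undefined) f z\<bar>" by simp
      also have "\<dots> \<le> M_deriv (d + 1) f"
        using z by (intro abs_iter_partial_deriv_le_M_deriv f) auto
      finally show "0 \<le> M_deriv (d + 1) f" .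
    qed (auto intro: sum_nonneg)
    also have "\<dots> < 1/2"
      using small by (simp add: field_simps)
    finally show False using w by simp
  qed
qed

section \<open>Separated points in sublevel sets on a line\<close>

text \<open>
  Pairing neighbouring points and applying the mean value theorem in every other gap halves the
  number of points, keeps the separation, and passes from \<open>g\<close> to its derivative.
\<close>

lemma no_separated_points_in_sublevel:
  fixes g :: "nat \<Rightarrow> real \<Rightarrow> real"
  assumes "convex I" and "\<eta> > 0"
    and "\<And>m s. m < k \<Longrightarrow> s \<in> I \<Longrightarrow> (g m has_real_derivative g (Suc m) s) (at s)"
    and "\<And>s. s \<in> I \<Longrightarrow> \<bar>g k s\<bar> > a"
    and "\<And>i. i < 2 ^ k \<Longrightarrow> t i \<in> I \<and> \<bar>g 0 (t i)\<bar> \<le> a * \<eta> ^ k"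
    and "\<And>i. Suc i < 2 ^ k \<Longrightarrow> t i + 2 * \<eta> \<le> t (Suc i)"
  shows False
  using assms
proof (induction k arbitrary: g t)
  case 0
  from "0.prems"(4)[of "t 0"] "0.prems"(5)[of 0] show False by simp
next
  case (Suc k)
  have I: "s \<in> I" if "x \<in> I" "y \<in> I" "x \<le> s" "s \<le> y" for s x y
    using \<open>convex I\<close> that by (metis is_interval_convex_1 mem_is_interval_1_I)
  \<comment> \<open>The two values differ by at most \<open>2 * a * \<eta> ^ Suc k\<close> over a
    gap of at least \<open>2 * \<eta>\<close>, so the slope at the mean value point is at most
    \<open>a * \<eta> ^ k\<close>.\<close>
  have "\<exists>s. t (2 * i) < s \<and> s < t (2 * i + 1) \<and> \<bar>g 1 s\<bar> \<le> a * \<eta> ^ k" if i: "i < 2 ^ k" for i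
  proof -
    let ?x = "t (2 * i)" and ?y = "t (2 * i + 1)"
    have xy: "?x + 2 * \<eta> \<le> ?y" and x: "?x \<in> I" "\<bar>g 0 ?x\<bar> \<le> a * \<eta> ^ Suc k"
      and y: "?y \<in> I" "\<bar>g 0 ?y\<bar> \<le> a * \<eta> ^ Suc k"
      using Suc.prems(5)[of "2 * i"] Suc.prems(5)[of "2 * i + 1"] Suc.prems(6)[of "2 * i"] i by auto
    have lt: "?x < ?y" using xy \<open>\<eta> > 0\<close> by linarith
    have "\<exists>s>?x. s < ?y \<and> g 0 ?y - g 0 ?x = (?y - ?x) * g 1 s"
      using I[OF x(1) y(1)] Suc.prems(3)[of 0] by (intro MVT2 lt) auto
    then obtain s where s: "?x < s" "s < ?y" "g 0 ?y - g 0 ?x = (?y - ?x) * g 1 s" by blast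
    have "2 * \<eta> * \<bar>g 1 s\<bar> \<le> (?y - ?x) * \<bar>g 1 s\<bar>"
      using xy by (intro mult_right_mono) auto
    also have "\<dots> = \<bar>g 0 ?y - g 0 ?x\<bar>"
      using lt unfolding s(3) abs_mult by simp
    also have "\<dots> \<le> 2 * \<eta> * (a * \<eta> ^ k)"
      using x(2) y(2) by (simp add: mult_ac)
    finally have "\<bar>g 1 s\<bar> \<le> a * \<eta> ^ k"
      using \<open>\<eta> > 0\<close> by simp
    with s show ?thesis by blast
  qed
  then obtain s where s: "\<And>i. i < 2 ^ k \<Longrightarrow>
      t (2 * i) < s i \<and> s i < t (2 * i + 1) \<and> \<bar>g 1 (s i)\<bar> \<le> a * \<eta> ^ k"
    by metis
  show False
  proof (rule Suc.IH[of "\<lambda>m. g (Suc m)" s])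
    show "s i \<in> I \<and> \<bar>g (Suc 0) (s i)\<bar> \<le> a * \<eta> ^ k" if "i < 2 ^ k" for i
      using I[of "t (2 * i)" "t (2 * i + 1)" "s i"] s[OF that]
        Suc.prems(5)[of "2 * i"] Suc.prems(5)[of "2 * i + 1"] that by auto
    \<comment> \<open>The gap from \<open>t (2 * i + 1)\<close> to \<open>t (2 * i + 2)\<close> lies
      between \<open>s i\<close> and \<open>s (Suc i)\<close>.\<close>
    show "s i + 2 * \<eta> \<le> s (Suc i)" if "Suc i < 2 ^ k" for i
      using s[of i] s[of "Suc i"] Suc.prems(6)[of "2 * i + 1"] that by force
  qed (use Suc.prems in auto)
qed

section \<open>Counting cubes by Lebesgue measure\<close>

text \<open>
  Averaging over translates of \<open>S\<close> along one direction replaces Fubini's theorem in that direction.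
\<close>

lemma emeasure_le_of_translates_overlap:
  fixes S B :: "'a::euclidean_space set"
  assumes S: "S \<in> sets borel" and B: "B \<in> sets borel"
    and sub: "\<And>j x. j < J \<Longrightarrow> c j + x \<in> S \<Longrightarrow> x \<in> B"
    and overlap: "\<And>x. card {j. j < J \<and> c j + x \<in> S} \<le> N"
  shows "of_nat J * emeasure lborel S \<le> of_nat N * emeasure lborel B"
proof -
  \<comment> \<open>Translation invariance of Lebesgue measure.\<close>
  have tr: "(\<integral>\<^sup>+x. indicator S (c j + x) \<partial>lborel) = emeasure lborel S" for j
  proof -
    have "emeasure lborel S = (\<integral>\<^sup>+x. indicator S x \<partial>distr lborel borel ((+) (c j)))"
      using S by (simp add: lborel_distr_plus)
    also have "\<dots> = (\<integral>\<^sup>+x. indicator S (c j + x) \<partial>lborel)"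
      using S by (intro nn_integral_distr) auto
    finally show ?thesis by simp
  qed
  have "of_nat J * emeasure lborel S = (\<Sum>j<J. \<integral>\<^sup>+x. indicator S (c j + x) \<partial>lborel)"
    by (simp add: tr)
  also have "\<dots> = (\<integral>\<^sup>+x. (\<Sum>j<J. indicator S (c j + x)) \<partial>lborel)"
    using S by (intro nn_integral_sum[symmetric] measurable_compose[OF _ borel_measurable_indicator]) auto
  also have "\<dots> \<le> (\<integral>\<^sup>+x. of_nat N * indicator B x \<partial>lborel)"
  proof (rule nn_integral_mono)
    fix x
    have "(\<Sum>j<J. indicator S (c j + x)) = (of_nat (card {j. j < J \<and> c j + x \<in> S}) :: ennreal)"
      by (simp add: indicator_def sum.If_cases Collect_conj_eq lessThan_def Int_commute)
    also have "\<dots> \<le> of_nat N * indicator B x"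
    proof (cases "x \<in> B")
      case True
      then show ?thesis using overlap[of x] by simp
    next
      case False
      then have empty: "{j. j < J \<and> c j + x \<in> S} = {}" using sub by blast
      show ?thesis unfolding empty by simp
    qed
    finally show "(\<Sum>j<J. indicator S (c j + x)) \<le> (of_nat N * indicator B x :: ennreal)" .
  qed
  also have "\<dots> = of_nat N * emeasure lborel B"
    using B by (simp add: nn_integral_cmult)
  finally show ?thesis .
qed

text \<open>The interiors of the grid cubes meeting \<open>Z\<close> are disjoint, so their volumes
  add up, and each of their points shares a closed cube with a point of \<open>Z\<close>. This makes
  the count accessible to the translation argument.\<close>

lemma covering_number_as_measure:
  fixes Z :: "(real^'n::finite) set"
  assumes "\<epsilon> > 0"
  obtains S where "S \<in> sets borel"
    and "emeasure lborel S = ennreal (real (covering_number \<epsilon> Z) * \<epsilon> ^ CARD('n))"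
    and "\<And>x. x \<in> S \<Longrightarrow> \<exists>y\<in>Z. dist x y \<le> real CARD('n) * \<epsilon>"
proof (cases "finite {Q \<in> grid_cubes \<epsilon>. Q \<inter> Z \<noteq> {}}")
  case False
  \<comment> \<open>An infinite set has \<open>card\<close> 0, so the empty set is the
    witness.\<close>
  then have "covering_number \<epsilon> Z = 0" by (simp add: covering_number_def)
  then show ?thesis using that[of "{}"] by simp
next
  case True
  define lo hi :: "int^'n \<Rightarrow> real^'n"
    where "lo = (\<lambda>k. \<chi> i. of_int (k $ i) * \<epsilon>)" and "hi = (\<lambda>k. \<chi> i. (of_int (k $ i) + 1) * \<epsilon>)"
  let ?F = "{Q \<in> grid_cubes \<epsilon>. Q \<inter> Z \<noteq> {}}"
  have "?F \<subseteq> range (\<lambda>k. cbox (lo k) (hi k))"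
    by (auto simp: grid_cubes_def lo_def hi_def)
  \<comment> \<open>\<open>K\<close> holds one index per cube, which makes the indexing injective by
    choice.\<close>
  then obtain K where K: "inj_on (\<lambda>k. cbox (lo k) (hi k)) K" "?F = (\<lambda>k. cbox (lo k) (hi k)) ` K"
    unfolding subset_image_inj by blast
  have finK: "finite K"
    using True unfolding K(2) using K(1) by (rule finite_imageD)
  have cardK: "covering_number \<epsilon> Z = card K"
    unfolding covering_number_def K(2) using K(1) by (rule card_image)
  have disj: "disjoint_family_on (\<lambda>k. box (lo k) (hi k)) K"
  proof (unfold disjoint_family_on_def, intro ballI impI)
    fix k l :: "int^'n" assume "k \<noteq> l"
    then obtain i where i: "k $ i \<noteq> l $ i" by (auto simp: vec_eq_iff)
    have False if "x \<in> box (lo k) (hi k)" "x \<in> box (lo l) (hi l)" for x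
    proof -
      \<comment> \<open>A common point forces the distinct integers \<open>k $ i\<close> and
        \<open>l $ i\<close> to differ by less than 1.\<close>
      have "of_int (k $ i) * \<epsilon> < (of_int (l $ i) + 1) * \<epsilon>" "of_int (l $ i) * \<epsilon> < (of_int (k $ i) + 1) * \<epsilon>"
        using that by (auto simp: mem_box_cart lo_def hi_def intro: less_trans)
      then have "real_of_int (k $ i) < of_int (l $ i) + 1" "real_of_int (l $ i) < of_int (k $ i) + 1"
        using assms by (simp_all only: mult_less_cancel_right_pos)
      then show False using i by linarith
    qed
    then show "box (lo k) (hi k) \<inter> box (lo l) (hi l) = {}" by blast
  qed
  have em: "emeasure lborel (box (lo k) (hi k)) = ennreal (\<epsilon> ^ CARD('n))" for k
  proof -
    have "(\<Prod>b\<in>Basis. (hi k - lo k) \<bullet> b) = (\<Prod>b\<in>(Basis :: (real^'n) set). \<epsilon>)"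
      by (intro prod.cong) (auto simp: Basis_vec_def inner_axis hi_def lo_def algebra_simps)
    moreover have "\<And>b. b \<in> Basis \<Longrightarrow> lo k \<bullet> b \<le> hi k \<bullet> b"
      using assms by (auto simp: Basis_vec_def inner_axis hi_def lo_def)
    ultimately show ?thesis by simp
  qed
  define S where "S = (\<Union>k\<in>K. box (lo k) (hi k))"
  have "emeasure lborel S = (\<Sum>k\<in>K. ennreal (\<epsilon> ^ CARD('n)))"
    unfolding S_def using disj finK by (subst sum_emeasure[symmetric]) (auto simp: em)
  also have "\<dots> = ennreal (real (covering_number \<epsilon> Z) * \<epsilon> ^ CARD('n))"
    using assms by (simp add: cardK ennreal_mult ennreal_of_nat_eq_real_of_nat)
  finally have "emeasure lborel S = ennreal (real (covering_number \<epsilon> Z) * \<epsilon> ^ CARD('n))" .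
  moreover have "\<exists>y\<in>Z. dist x y \<le> real CARD('n) * \<epsilon>" if x: "x \<in> S" for x
  proof -
    obtain k where k: "k \<in> K" "x \<in> box (lo k) (hi k)" using x by (auto simp: S_def)
    then obtain y where y: "y \<in> cbox (lo k) (hi k)" "y \<in> Z" using K(2) by blast
    \<comment> \<open>The factor \<open>CARD('n)\<close> comes from bounding the norm by the l1
      norm.\<close>
    have "\<bar>(x - y) $ i\<bar> \<le> \<epsilon>" for i
    proof -
      have "lo k $ i < x $ i" "x $ i < hi k $ i" "lo k $ i \<le> y $ i" "y $ i \<le> hi k $ i"
        "hi k $ i = lo k $ i + \<epsilon>"
        using k y by (auto simp: mem_box_cart lo_def hi_def algebra_simps)
      then show ?thesis by simp
    qed
    then have "(\<Sum>i\<in>UNIV. \<bar>(x - y) $ i\<bar>) \<le> real CARD('n) * \<epsilon>"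
      using sum_bounded_above[of UNIV "\<lambda>i. \<bar>(x - y) $ i\<bar>" \<epsilon>] by simp
    then show ?thesis
      using y norm_le_l1_cart[of "x - y"] by (auto simp: dist_norm intro!: bexI[of _ y])
  qed
  moreover have "S \<in> sets borel" unfolding S_def using finK by auto
  ultimately show ?thesis by (intro that)
qed

text \<open>All hits lie on the line through \<open>x\<close> in direction \<open>v\<close>, at
  parameters that are distinct multiples of \<open>2 * \<eta>\<close>. More than
  \<open>2 ^ k\<close> of them would contradict
  \<open>no_separated_points_in_sublevel\<close>.\<close>

lemma card_translates_in_sublevel_le:
  fixes f :: "real^'n::finite \<Rightarrow> real"
  assumes f: "Ck_smooth k f" and "\<eta> > 0"
    and V: "convex V" "V \<subseteq> ball 0 1"
    and big: "\<And>y. y \<in> V \<Longrightarrow> \<bar>dir_deriv v k f y\<bar> > a"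
    and S: "\<And>y. y \<in> S \<Longrightarrow> y \<in> V \<and> \<bar>f y\<bar> \<le> a * \<eta> ^ k"
  shows "card {j. j < (J::nat) \<and> (2 * \<eta> * real j) *\<^sub>R v + x \<in> S} \<le> 2 ^ k"
proof (rule ccontr)
  let ?E = "{j. j < J \<and> (2 * \<eta> * real j) *\<^sub>R v + x \<in> S}"
  assume "\<not> card ?E \<le> 2 ^ k"
  then have gt: "2 ^ k < card ?E" by simp
  have "finite ?E" by simp
  \<comment> \<open>\<open>h\<close> lists the hits in increasing order; its first
    \<open>2 ^ k\<close> values are used.\<close>
  then obtain h where h: "bij_betw h {..<card ?E} ?E" "strict_mono_on {..<card ?E} h"
    by (rule ex_bij_betw_strict_mono_card)
  let ?t = "\<lambda>i. 2 * \<eta> * real (h i)"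
  let ?I = "{t. x + t *\<^sub>R v \<in> V}"
  show False
  proof (rule no_separated_points_in_sublevel[of ?I \<eta> k "\<lambda>m t. dir_deriv v m f (x + t *\<^sub>R v)" a ?t])
    show "convex ?I"
    proof (rule convexI)
      fix s t p q :: real
      assume "s \<in> ?I" "t \<in> ?I" and pq: "0 \<le> p" "0 \<le> q" "p + q = 1"
      then have "p *\<^sub>R (x + s *\<^sub>R v) + q *\<^sub>R (x + t *\<^sub>R v) \<in> V"
        using V(1) by (auto intro: convexD)
      moreover have "p *\<^sub>R (x + s *\<^sub>R v) + q *\<^sub>R (x + t *\<^sub>R v) = (p + q) *\<^sub>R x + (p * s + q * t) *\<^sub>R v"
        by (simp add: algebra_simps)
      ultimately show "p *\<^sub>R s + q *\<^sub>R t \<in> ?I" using pq by simp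
    qed
    show "?t i \<in> ?I \<and> \<bar>dir_deriv v 0 f (x + ?t i *\<^sub>R v)\<bar> \<le> a * \<eta> ^ k" if "i < 2 ^ k" for i
    proof -
      have "h i \<in> ?E" using bij_betwE[OF h(1)] gt that by auto
      then show ?thesis using S[of "?t i *\<^sub>R v + x"] by (simp add: add.commute)
    qed
    show "?t i + 2 * \<eta> \<le> ?t (Suc i)" if "Suc i < 2 ^ k" for i
    proof -
      have "h i < h (Suc i)" using strict_mono_onD[OF h(2), of i "Suc i"] gt that by simp
      then have "2 * \<eta> * (real (h i) + 1) \<le> 2 * \<eta> * real (h (Suc i))"
        using \<open>\<eta> > 0\<close> by (intro mult_left_mono) auto
      then show ?thesis by (simp add: algebra_simps)
    qed
    show "((\<lambda>t. dir_deriv v m f (x + t *\<^sub>R v)) has_real_derivative dir_deriv v (Suc m) f (x + s *\<^sub>R v)) (at s)"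
      if "m < k" "s \<in> ?I" for m s
      using that V(2) Ck_smooth_mono[OF f, of "Suc m"] by (intro dir_deriv_has_real_derivative) auto
  qed (use big \<open>\<eta> > 0\<close> in auto)
qed

section \<open>Local bound for the covering numbers\<close>

text \<open>Mean value inequality on a convex set, with the first partials bounded by
  \<open>M_deriv 1 f\<close>.\<close>

lemma Ck_smooth_1_lipschitz:
  fixes f :: "real^'n::finite \<Rightarrow> real"
  assumes f: "Ck_smooth 1 f" and V: "convex V" "V \<subseteq> ball 0 1"
  obtains L where "L > 0" and "\<And>x y. x \<in> V \<Longrightarrow> y \<in> V \<Longrightarrow> \<bar>f x - f y\<bar> \<le> L * dist x y"
proof -
  let ?L = "real CARD('n) * M_deriv 1 f"
  have diff: "f differentiable_on unit_ball"
    using f by simp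
  have le: "\<bar>f x - f y\<bar> \<le> ?L * dist x y" if xy: "x \<in> V" "y \<in> V" for x y
  proof -
    have "norm (f x - f y) \<le> ?L * norm (x - y)"
    proof (rule differentiable_bound[where f' = "\<lambda>u h. dir_deriv h 1 f u", OF V(1) _ _ xy])
      fix u assume "u \<in> V"
      then have u: "u \<in> ball 0 1" using V(2) by blast
      show "(f has_derivative (\<lambda>h. dir_deriv h 1 f u)) (at u within V)"
        by (rule has_derivative_at_withinI[OF frechet_derivative_eq_dir_deriv[OF diff u]])
      show "onorm (\<lambda>h. dir_deriv h 1 f u) \<le> ?L"
      proof (rule onorm_le)
        fix h :: "real^'n"
        have le: "\<bar>iter_partial_deriv is f u\<bar> \<le> M_deriv 1 f" if "length is = 1" for "is"
          using u by (intro abs_iter_partial_deriv_le_M_deriv f that) simp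
        have "0 \<le> M_deriv 1 f" using le[of "[undefined]"] by simp
        then have "(\<Sum>i\<in>UNIV. \<bar>h $ i\<bar>) ^ 1 * M_deriv 1 f \<le> (real CARD('n) * norm h) * M_deriv 1 f"
          using sum_abs_components_le[of h] by (simp add: mult_right_mono)
        then show "norm (dir_deriv h 1 f u) \<le> ?L * norm h"
          using abs_dir_deriv_le[of 1 f u "M_deriv 1 f" h, OF le]
          by (simp add: mult.assoc mult.commute[of "norm h"] del: dir_deriv.simps)
      qed
    qed
    then show ?thesis by (simp add: dist_norm)
  qed
  \<comment> \<open>The added 1 makes the constant positive.\<close>
  have "\<bar>f x - f y\<bar> \<le> (\<bar>?L\<bar> + 1) * dist x y" if "x \<in> V" "y \<in> V" for x y
  proof -
    have "?L * dist x y \<le> (\<bar>?L\<bar> + 1) * dist x y" by (intro mult_right_mono) auto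
    then show ?thesis using le[OF that] by linarith
  qed
  moreover have "\<bar>?L\<bar> + 1 > 0" by linarith
  ultimately show ?thesis by (intro that[of "\<bar>?L\<bar> + 1"]) auto
qed

text \<open>Near \<open>z\<close> the derivative of order \<open>k\<close> along \<open>v\<close>
  exceeds \<open>a\<close> in absolute value, so translates of the cubes near \<open>Z\<close> by
  multiples of \<open>2 * \<eta>\<close> overlap at most \<open>2 ^ k\<close>-fold. About
  \<open>1 / (2 * \<eta>)\<close> translates fit into a fixed ball, so the cubes have total volume
  O(\<eta>), where \<eta> is of order \<open>\<epsilon> powr (1 / k)\<close>. Stating the exponent
  with \<open>d\<close> makes it the same for all \<open>z\<close>.\<close>

lemma covering_number_local_bound:
  fixes f :: "real^'n::finite \<Rightarrow> real"
  assumes f: "Ck_smooth k f" and z: "z \<in> ball 0 1"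
    and fZ: "\<And>x. x \<in> Z \<Longrightarrow> f x = 0" and k: "0 < k" "k \<le> d" and nz: "dir_deriv v k f z \<noteq> 0"
  shows "\<exists>r C. r > 0 \<and> (\<forall>\<^sub>F \<epsilon> in at_right 0.
           real (covering_number \<epsilon> (Z \<inter> ball z r)) \<le> C * \<epsilon> powr (1 / real d - real CARD('n)))"
proof -
  let ?n = "real CARD('n)"
  define a where "a = \<bar>dir_deriv v k f z\<bar> / 2"
  have a: "a > 0" using nz by (simp add: a_def)
  have "isCont (dir_deriv v k f) z"
    using continuous_on_interior[OF continuous_on_dir_deriv[OF f]] z by (simp add: interior_cball)
  then have "((\<lambda>y. \<bar>dir_deriv v k f y\<bar>) \<longlongrightarrow> \<bar>dir_deriv v k f z\<bar>) (nhds z)"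
    by (intro tendsto_rabs) (simp add: isCont_def tendsto_at_iff_tendsto_nhds)
  then have "\<forall>\<^sub>F y in nhds z. a < \<bar>dir_deriv v k f y\<bar>"
    by (rule order_tendstoD) (use nz in \<open>simp add: a_def\<close>)
  moreover have "\<forall>\<^sub>F y in nhds z. y \<in> ball 0 1"
    using z by (intro eventually_nhds_in_open) auto
  ultimately have "\<forall>\<^sub>F y in nhds z. a < \<bar>dir_deriv v k f y\<bar> \<and> y \<in> ball 0 1"
    by eventually_elim simp
  then obtain \<rho> where \<rho>: "\<rho> > 0" and near: "\<And>y. dist y z \<le> \<rho> \<Longrightarrow> a < \<bar>dir_deriv v k f y\<bar> \<and> y \<in> ball 0 1"
    unfolding eventually_nhds_metric_le by blast
  let ?V = "cball z \<rho>"
  have V: "?V \<subseteq> ball 0 1" and big: "\<And>y. y \<in> ?V \<Longrightarrow> a < \<bar>dir_deriv v k f y\<bar>"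
    using near by (auto simp: dist_commute)
  obtain L where L: "L > 0" "\<And>x y. x \<in> ?V \<Longrightarrow> y \<in> ?V \<Longrightarrow> \<bar>f x - f y\<bar> \<le> L * dist x y"
    using Ck_smooth_1_lipschitz[OF Ck_smooth_mono[OF f] _ V] k by auto
  \<comment> \<open>Chosen so that \<open>\<eta> = (c * \<epsilon>) powr (1 / k)\<close> solves
    \<open>a * \<eta> ^ k = L * n * \<epsilon>\<close> with \<open>n = CARD('n)\<close>, the bound
    on \<open>f\<close> at distance at most \<open>n * \<epsilon>\<close> from a zero.\<close>
  define c where "c = L * ?n / a"
  have c: "c > 0" using L a by (simp add: c_def)
  \<comment> \<open>The translations have length at most \<open>norm v\<close>.\<close>
  let ?B = "cball z (\<rho> + norm v)"
  define C where "C = 4 * (2 ^ k * measure lborel ?B) * c powr (1 / real k)"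
  have "((\<lambda>\<epsilon>. (c * \<epsilon>) powr (1 / real k)) \<longlongrightarrow> 0) (at_right 0)"
    using c k tendsto_powr'[of "\<lambda>\<epsilon>. c * \<epsilon>" 0 "at_right 0" "\<lambda>_. 1 / real k" "1 / real k"]
    by (auto simp: eventually_at_filter intro!: tendsto_eq_intros)
  then have "\<forall>\<^sub>F \<epsilon> in at_right 0. (c * \<epsilon>) powr (1 / real k) < 1 / 4"
    by (rule order_tendstoD) simp
  \<comment> \<open>Cubes that meet the ball of radius \<open>\<rho> / 2\<close> then stay within
    \<open>?V\<close>.\<close>
  moreover have "\<forall>\<^sub>F \<epsilon>::real in at_right 0. 0 < \<epsilon> \<and> \<epsilon> < min 1 (\<rho> / (2 * ?n))"
    unfolding eventually_at_right_field
    using \<rho> by (intro exI[of _ "min 1 (\<rho> / (2 * ?n))"]) auto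
  ultimately have "\<forall>\<^sub>F \<epsilon> in at_right 0.
      real (covering_number \<epsilon> (Z \<inter> ball z (\<rho> / 2))) \<le> C * \<epsilon> powr (1 / real d - ?n)"
  proof eventually_elim
    case (elim \<epsilon>)
    define \<eta> where "\<eta> = (c * \<epsilon>) powr (1 / real k)"
    have \<epsilon>: "0 < \<epsilon>" "\<epsilon> < 1" "?n * \<epsilon> \<le> \<rho> / 2" and \<eta>: "0 < \<eta>" "\<eta> < 1 / 4"
      using elim c by (auto simp: \<eta>_def field_simps)
    have \<eta>k: "a * \<eta> ^ k = L * (?n * \<epsilon>)"
    proof -
      have "\<eta> ^ k = (c * \<epsilon>) powr (1 / real k * real k)"
        using c \<epsilon> by (simp add: \<eta>_def powr_powr flip: powr_realpow)
      also have "\<dots> = c * \<epsilon>" using k c \<epsilon> by simp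
      finally show ?thesis using a by (simp add: c_def)
    qed
    let ?N = "real (covering_number \<epsilon> (Z \<inter> ball z (\<rho> / 2)))"
    obtain S where S: "S \<in> sets borel"
      and emS: "emeasure lborel S = ennreal (?N * \<epsilon> ^ CARD('n))"
      and nearZ: "\<And>x. x \<in> S \<Longrightarrow> \<exists>y\<in>Z \<inter> ball z (\<rho> / 2). dist x y \<le> ?n * \<epsilon>"
      using covering_number_as_measure[OF \<epsilon>(1)] by metis
    have Sub: "x \<in> ?V \<and> \<bar>f x\<bar> \<le> a * \<eta> ^ k" if x: "x \<in> S" for x
    proof -
      obtain y where y: "y \<in> Z" "dist z y < \<rho> / 2" "dist x y \<le> ?n * \<epsilon>"
        using nearZ[OF x] by auto
      then have "dist z x \<le> \<rho>" "dist z y \<le> \<rho>"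
        using dist_triangle2[of z x y] \<epsilon> \<rho> by linarith+
      then have "x \<in> ?V" "y \<in> ?V" by auto
      then have "\<bar>f x\<bar> \<le> L * dist x y" using L(2)[of x y] fZ[OF y(1)] by simp
      also have "\<dots> \<le> L * (?n * \<epsilon>)" using L(1) y by (intro mult_left_mono) auto
      finally show ?thesis using \<open>x \<in> ?V\<close> \<eta>k by simp
    qed
    \<comment> \<open>The largest number of steps of length \<open>2 * \<eta>\<close> with total at
      most 1.\<close>
    define J where "J = nat \<lfloor>1 / (2 * \<eta>)\<rfloor>"
    have "0 \<le> 1 / (2 * \<eta>)" using \<eta> by simp
    then have J: "real J \<le> 1 / (2 * \<eta>)" "real J \<ge> 1 / (2 * \<eta>) - 1"
      unfolding J_def by linarith+
    have "of_nat J * emeasure lborel S \<le> of_nat (2 ^ k) * emeasure lborel ?B"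
    proof (rule emeasure_le_of_translates_overlap[OF S, where c = "\<lambda>j. (2 * \<eta> * real j) *\<^sub>R v"])
      show "card {j. j < J \<and> (2 * \<eta> * real j) *\<^sub>R v + x \<in> S} \<le> 2 ^ k" for x
        using \<eta> Sub big by (intro card_translates_in_sublevel_le[OF f _ _ V]) auto
      fix j x assume j: "j < J" and "(2 * \<eta> * real j) *\<^sub>R v + x \<in> S"
      then have "dist z ((2 * \<eta> * real j) *\<^sub>R v + x) \<le> \<rho>" using Sub by auto
      moreover have "dist ((2 * \<eta> * real j) *\<^sub>R v + x) x \<le> 1 * norm v"
      proof -
        have "2 * \<eta> * real j \<le> 2 * \<eta> * (1 / (2 * \<eta>))"
          using j J \<eta> by (intro mult_left_mono) auto
        then have "2 * \<eta> * real j \<le> 1" using \<eta> by simp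
        moreover have "dist ((2 * \<eta> * real j) *\<^sub>R v + x) x = (2 * \<eta> * real j) * norm v"
          using \<eta> by (simp add: dist_norm)
        ultimately show ?thesis using mult_right_mono[of "2 * \<eta> * real j" 1 "norm v"] by simp
      qed
      ultimately show "x \<in> ?B"
        using dist_triangle[of z x "(2 * \<eta> * real j) *\<^sub>R v + x"] by simp
    qed auto
    moreover have "emeasure lborel ?B = ennreal (measure lborel ?B)"
      using emeasure_lborel_cball_finite[of z "\<rho> + norm v"] by (intro emeasure_eq_ennreal_measure) auto
    ultimately have "ennreal (real J * (?N * \<epsilon> ^ CARD('n))) \<le> ennreal (2 ^ k * measure lborel ?B)"
      using \<epsilon> by (simp add: emS ennreal_mult ennreal_of_nat_eq_real_of_nat flip: ennreal_power)
    then have le: "real J * (?N * \<epsilon> ^ CARD('n)) \<le> 2 ^ k * measure lborel ?B"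
      by (subst (asm) ennreal_le_iff) auto
    \<comment> \<open>Since \<open>\<eta> < 1 / 4\<close>, rounding down loses at most half of
      \<open>1 / (2 * \<eta>)\<close>.\<close>
    have "1 / (4 * \<eta>) \<le> real J"
    proof -
      have "1 / (2 * \<eta>) = 1 / (4 * \<eta>) + 1 / (4 * \<eta>)" "1 \<le> 1 / (4 * \<eta>)"
        using \<eta> by (auto simp: field_simps)
      then show ?thesis using J by linarith
    qed
    then have "1 / (4 * \<eta>) * (?N * \<epsilon> ^ CARD('n)) \<le> real J * (?N * \<epsilon> ^ CARD('n))"
      using \<epsilon> by (intro mult_right_mono) auto
    with le have "1 / (4 * \<eta>) * (?N * \<epsilon> ^ CARD('n)) \<le> 2 ^ k * measure lborel ?B"
      by linarith
    then have "?N * \<epsilon> ^ CARD('n) \<le> 4 * (2 ^ k * measure lborel ?B) * \<eta>"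
      using \<eta> by (simp add: pos_divide_le_eq mult_ac)
    also have "\<dots> = C * \<epsilon> powr (1 / real k)"
      using c \<epsilon> by (simp add: C_def \<eta>_def powr_mult)
    \<comment> \<open>Here \<open>\<epsilon> < 1\<close> and \<open>k \<le> d\<close>.\<close>
    also have "\<dots> \<le> C * \<epsilon> powr (1 / real d)"
      using \<epsilon> k by (intro mult_left_mono powr_mono') (auto simp: C_def field_simps)
    finally have "?N \<le> C * \<epsilon> powr (1 / real d) / \<epsilon> powr ?n"
      using \<epsilon> by (simp add: field_simps powr_realpow)
    then show ?case by (simp add: powr_diff)
  qed
  then show ?thesis using \<rho> by (intro exI[of _ "\<rho> / 2"] exI[of _ C]) auto
qed

section \<open>Box dimension and the global argument\<close>

lemma covering_number_UN_le:
  assumes "finite A"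
  shows "covering_number \<epsilon> (\<Union>a\<in>A. Y a) \<le> (\<Sum>a\<in>A. covering_number \<epsilon> (Y a))"
proof -
  have Un: "{Q \<in> grid_cubes \<epsilon>. Q \<inter> (\<Union>a\<in>A. Y a) \<noteq> {}} = (\<Union>a\<in>A. {Q \<in> grid_cubes \<epsilon>. Q \<inter> Y a \<noteq> {}})"
    by auto
  show ?thesis
    unfolding covering_number_def Un using assms by (rule card_UN_le)
qed

text \<open>The gap between \<open>p\<close> and \<open>q\<close> absorbs the constant: once
  \<open>C * \<epsilon> powr (q - p) < 1\<close>, the count is at most
  \<open>\<epsilon> powr (- q)\<close>.\<close>

lemma box_dim_le:
  fixes Z :: "(real^'n::finite) set"
  assumes ev: "\<forall>\<^sub>F \<epsilon> in at_right 0. real (covering_number \<epsilon> Z) \<le> C * \<epsilon> powr (- p)"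
    and "p < q" "0 \<le> q"
  shows "box_dim Z \<le> ereal q"
proof -
  have "((\<lambda>\<epsilon>::real. C * \<epsilon> powr (q - p)) \<longlongrightarrow> C * 0) (at_right 0)"
  proof (intro tendsto_intros)
    show "((\<lambda>\<epsilon>::real. \<epsilon> powr (q - p)) \<longlongrightarrow> 0) (at_right 0)"
      using \<open>p < q\<close> tendsto_powr'[OF tendsto_ident_at tendsto_const, of 0 "q - p" "{0::real<..}"]
      by (auto simp: eventually_at_filter)
  qed
  then have "\<forall>\<^sub>F \<epsilon>::real in at_right 0. C * \<epsilon> powr (q - p) < 1"
    by (rule order_tendstoD) simp
  moreover have "\<forall>\<^sub>F \<epsilon>::real in at_right 0. 0 < \<epsilon> \<and> \<epsilon> < 1"
    unfolding eventually_at_right_field by (intro exI[of _ 1]) auto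
  ultimately have "\<forall>\<^sub>F \<epsilon> in at_right 0. ereal (ln (real (covering_number \<epsilon> Z)) / ln (1 / \<epsilon>)) \<le> ereal q"
    using ev
  proof eventually_elim
    case (elim \<epsilon>)
    let ?N = "real (covering_number \<epsilon> Z)"
    have ln: "ln (1 / \<epsilon>) > 0" using elim by simp
    have "ln ?N \<le> q * ln (1 / \<epsilon>)"
    \<comment> \<open>For a zero count \<open>ln 0 = 0\<close>, and \<open>0 \<le> q\<close> settles
      the case.\<close>
    proof (cases "?N = 0")
      case True
      then show ?thesis using ln \<open>0 \<le> q\<close> by simp
    next
      case False
      have "C * \<epsilon> powr (- p) = C * \<epsilon> powr (q - p) * \<epsilon> powr (- q)"
        by (simp add: mult.assoc powr_add[symmetric])
      also have "\<dots> \<le> 1 * \<epsilon> powr (- q)"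
        using elim by (intro mult_right_mono) auto
      finally have "?N \<le> \<epsilon> powr (- q)" using elim by linarith
      then have "ln ?N \<le> ln (\<epsilon> powr (- q))"
        using False elim by (subst ln_le_cancel_iff) auto
      also have "\<dots> = q * ln (1 / \<epsilon>)"
        using elim by (simp add: ln_powr ln_div)
      finally show ?thesis .
    qed
    then show ?case using ln by (simp add: divide_le_eq)
  qed
  then show ?thesis unfolding box_dim_def by (rule Limsup_bounded)
qed

theorem theorem1p1:
  fixes d :: nat
  assumes "d \<ge> 1"
  shows "\<exists>M::real. M > 0 \<and>
    (\<forall>Z :: (real^'n::finite) set.
       closed Z \<and> Z \<subseteq> cball 0 (1/3) \<and>
       box_dim Z > ereal (real CARD('n) - 1 / (real d + 1)) \<longrightarrow>
       rigidity d Z \<ge> ereal M)"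
\<comment> \<open>The witness is the threshold of \<open>ex_dir_deriv_nonzero\<close>.\<close>
proof (intro exI[of _ "1 / (2 * (2 * real CARD('n)) ^ (d + 1))"] conjI allI impI)
  show "0 < 1 / (2 * (2 * real CARD('n)) ^ (d + 1))" by simp
  fix Z :: "(real^'n) set"
  assume Z: "closed Z \<and> Z \<subseteq> cball 0 (1/3) \<and> box_dim Z > ereal (real CARD('n) - 1 / (real d + 1))"
  have "compact Z"
    using Z compact_eq_bounded_closed bounded_subset bounded_cball by blast
  have "1 / (2 * (2 * real CARD('n)) ^ (d + 1)) \<le> M_deriv (d + 1) f" if "f \<in> U_class d Z" for f
  proof (rule ccontr)
    assume "\<not> ?thesis"
    then have small: "M_deriv (d + 1) f < 1 / (2 * (2 * real CARD('n)) ^ (d + 1))" by simp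
    have f: "Ck_smooth (d + 1) f" and fZ: "\<And>x. x \<in> Z \<Longrightarrow> f x = 0" and M0: "M_deriv 0 f = 1"
      using that by (auto simp: U_class_def)
    define P where "P z r C \<longleftrightarrow> r > 0 \<and> (\<forall>\<^sub>F \<epsilon> in at_right 0.
           real (covering_number \<epsilon> (Z \<inter> ball z r)) \<le> C * \<epsilon> powr (1 / real d - real CARD('n)))" for z r C
    have "\<exists>r C. P z r C" if z: "z \<in> Z" for z
    proof -
      have zb: "z \<in> ball 0 1" using Z z by auto
      obtain v k where vk: "k \<le> d" "dir_deriv v k f z \<noteq> 0"
        using ex_dir_deriv_nonzero[OF f M0 small zb] by blast
      \<comment> \<open>Order 0 is excluded because \<open>dir_deriv v 0 f z\<close> is
        \<open>f z = 0\<close>.\<close>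
      moreover have "k > 0" using vk fZ[OF z] by (cases k) auto
      ultimately show ?thesis
        using covering_number_local_bound[OF Ck_smooth_mono[OF f] zb fZ, of k Z d v] unfolding P_def by simp
    qed
    then obtain r C where "\<And>z. z \<in> Z \<Longrightarrow> P z (r z) (C z)"
      by metis
    then have r: "\<And>z. z \<in> Z \<Longrightarrow> r z > 0"
      and C: "\<And>z. z \<in> Z \<Longrightarrow> \<forall>\<^sub>F \<epsilon> in at_right 0. real (covering_number \<epsilon> (Z \<inter> ball z (r z)))
                \<le> C z * \<epsilon> powr (1 / real d - real CARD('n))"
      unfolding P_def by blast+
    have "Z \<subseteq> (\<Union>z\<in>Z. ball z (r z))"
      using r by auto
    \<comment> \<open>A finite subcover turns the local bounds into one, whose constant is the sum
      of the local constants.\<close>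
    then obtain A where A: "A \<subseteq> Z" "finite A" "Z \<subseteq> (\<Union>z\<in>A. ball z (r z))"
      using compactE_image[OF \<open>compact Z\<close>, of Z "\<lambda>z. ball z (r z)"] by auto
    have "\<forall>\<^sub>F \<epsilon> in at_right 0. \<forall>z\<in>A. real (covering_number \<epsilon> (Z \<inter> ball z (r z)))
                \<le> C z * \<epsilon> powr (1 / real d - real CARD('n))"
      using A C by (intro eventually_ball_finite) auto
    then have "\<forall>\<^sub>F \<epsilon> in at_right 0.
        real (covering_number \<epsilon> Z) \<le> (\<Sum>z\<in>A. C z) * \<epsilon> powr (- (real CARD('n) - 1 / real d))"
    proof eventually_elim
      case (elim \<epsilon>)
      have Un: "(\<Union>z\<in>A. Z \<inter> ball z (r z)) = Z" using A(3) by blast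
      have "covering_number \<epsilon> Z \<le> (\<Sum>z\<in>A. covering_number \<epsilon> (Z \<inter> ball z (r z)))"
        using covering_number_UN_le[OF A(2), of \<epsilon> "\<lambda>z. Z \<inter> ball z (r z)"] unfolding Un .
      then have "real (covering_number \<epsilon> Z) \<le> real (\<Sum>z\<in>A. covering_number \<epsilon> (Z \<inter> ball z (r z)))"
        by (rule of_nat_mono)
      also have "\<dots> = (\<Sum>z\<in>A. real (covering_number \<epsilon> (Z \<inter> ball z (r z))))"
        by (rule of_nat_sum)
      also have "\<dots> \<le> (\<Sum>z\<in>A. C z * \<epsilon> powr (1 / real d - real CARD('n)))"
        using elim by (intro sum_mono) auto
      finally show ?case by (simp add: sum_distrib_right)
    qed
    \<comment> \<open>This strict gap is the one \<open>box_dim_le\<close> asks for;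
      \<open>d \<ge> 1\<close> rules out the default \<open>1 / 0 = 0\<close>.\<close>
    moreover have "real CARD('n) - 1 / real d < real CARD('n) - 1 / (real d + 1)"
      using assms by (simp add: field_simps)
    moreover have "0 \<le> real CARD('n) - 1 / (real d + 1)"
    proof -
      have "1 / (real d + 1) \<le> 1" by simp
      moreover have "1 \<le> real CARD('n)"
        using zero_less_card_finite[where 'a = 'n] by linarith
      ultimately show ?thesis by linarith
    qed
    ultimately have "box_dim Z \<le> ereal (real CARD('n) - 1 / (real d + 1))"
      by (rule box_dim_le)
    then show False using Z by (meson leD)
  qed
  then show "rigidity d Z \<ge> ereal (1 / (2 * (2 * real CARD('n)) ^ (d + 1)))"
    unfolding rigidity_def by (intro INF_greatest) simp
qed

end
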